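(* Let $\Gamma=(N,A,\mathcal F,\Xi,u)$ be a strategic form game with finitely additive strategies. Then every M-perfect equilibrium of $\Gamma$ is a perfect equilibrium of $\Gamma$.
   Context: A directed set $(I,\le)$ is a non-empty set with a reflexive, transitive relation such that every pair has an upper bound and there is no maximal element (for every $\alpha$ there is $\beta\ge\alpha$ with $\beta\neq\alpha$). Nets are indexed by directed sets; convergence is as usual. A field on a set $X$ is a collection of subsets containing $\emptyset$ and closed under complements and finite unions. A charge on a field is a finitely additive $[0,1]$-valued set function with total mass $1$. A strategic form game with finitely additive strategies $\Gamma=(N,A,\mathcal F,\Xi,u)$ consists of: $N=\{1,\dots,n\}$; $A=\prod_{i\in N}A_i$ with each $A_i$ non-empty; $\mathcal F=(\mathcal F_i)_{i\in N}$ with $\mathcal F_i$ a field on $A_i$ containing all singletons; $\Xi=\prod_i\Xi_i$, where $\Xi_i$ is the set of all charges on $\mathcal F_i$; and bounded functions $u_i\colon A\to\mathbb R$, each of which is a uniform limit of simple functions. A rectangle is a set $R=\prod_iR_i$ with $R_i\in\mathcal F_i$, and $\kappa(R)=\prod_i\kappa_i(R_i)$ for $\kappa\in\Xi$; a simple function is a finite sum $f=\sum_\ell c_\ell\mathbb I_{R^\ell}$ with $R^\ell$ rectangles and $c_\ell\in\mathbb R$, and $\kappa(f)=\sum_\ell c_\ell\kappa(R^\ell)$. The payoff function $U_i\colon\Xi\to\mathbb R$ is the expected payoff $U_i(\kappa)=\sup\{\kappa(f)\mid f\text{ simple},f\le u_i\}=\inf\{\kappa(g)\mid g\text{ simple},g\ge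 u_i\}$ (these agree for uniform limits of simple functions). $\Xi$ has the Tychonov topology: the smallest topology containing all sets $\{\tau\in\Xi\mid|\kappa(R^k)-\tau(R^k)|<\varepsilon,\ k=1,\dots,\ell\}$ with $\kappa\in\Xi$, $\varepsilon>0$ and rectangles $R^1,\dots,R^\ell$. $(\tau_i\mid\sigma)$ is the profile $\sigma$ with $\sigma_i$ replaced by $\tau_i$. $\tau_i\in\Xi_i$ is a best response to $\sigma\in\Xi$ if $U_i(\tau_i\mid\sigma)\ge U_i(\tau_i'\mid\sigma)$ for all $\tau_i'\in\Xi_i$; a profile $\tau$ is a best response to $\sigma$ if each $\tau_i$ is. $\sigma$ is a Nash equilibrium if it is a best response to itself. The carrier of $\sigma_i\in\Xi_i$ is $\mathcal C_i(\sigma_i)=\{E\in\mathcal F_i\mid\sigma_i(E)>0\}$, and $\mathcal C(\sigma)=\prod_i\mathcal C_i(\sigma_i)$. A carrier is a set of the form $\mathcal C(\sigma)$ with $\sigma\in\Xi$. $\sigma_i$ has maximal carrier if $\mathcal C_i(\sigma_i)=\mathcal F_i\setminus\{\emptyset\}$; a profile has maximal carrier if each of its strategies does. A net $(\sigma_\alpha)_{\alpha\in I}$ in $\Xi$ is completely mixed if for every carrier $\mathcal C$ there is $\alpha\in I$ with $\mathcal C\subseteq\mathcal C(\sigma_\beta)$ for all $\beta\ge\alpha$. $\sigma$ is perfect if there are a completely mixed net $(\sigma_\alpha)_{\alpha\in I}$ and a net $(\kappa_\alpha)_{\alpha\in I}$ in $\Xi$, both converging to $\sigma$, such that $\kappa_\alpha$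 is a best response to $\sigma_\alpha$ for each $\alpha\in I$. A perfect equilibrium is a Nash equilibrium that is perfect. For $\tau\in\Xi$ and a vector $\varepsilon=(\varepsilon_1,\dots,\varepsilon_n)>0$ (all $\varepsilon_i>0$), let $\Xi_i(\tau_i,\varepsilon_i)=\{(1-\varepsilon_i)\kappa_i+\varepsilon_i\tau_i\mid\kappa_i\in\Xi_i\}$, and let $\Gamma(\tau,\varepsilon)$ be the game in which each player $i$ may only choose strategies in $\Xi_i(\tau_i,\varepsilon_i)$, with the same payoffs. A Nash equilibrium $\kappa\in\Xi$ of $\Gamma$ is M-perfect if for every open $U\ni\kappa$ and every $\eta>0$ there are a vector $\varepsilon>0$ with $\|\varepsilon\|<\eta$ and a strategy profile $\tau\in\Xi$ with maximal carrier such that $\Gamma(\tau,\varepsilon)$ admits a Nash equilibrium $\sigma\in U$. *)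

theory Defs
  imports "HOL-Analysis.Analysis"
begin

section \<open>Nets\<close>

definition directed_set :: "'i set \<Rightarrow> ('i \<Rightarrow> 'i \<Rightarrow> bool) \<Rightarrow> bool" where
  "directed_set I le \<longleftrightarrow>
     I \<noteq> {} \<and>
     (\<forall>a\<in>I. le a a) \<and>
     (\<forall>a\<in>I. \<forall>b\<in>I. \<forall>c\<in>I. le a b \<longrightarrow> le b c \<longrightarrow> le a c) \<and>
     (\<forall>a\<in>I. \<forall>b\<in>I. \<exists>c\<in>I. le a c \<and> le b c) \<and>
     (\<forall>a\<in>I. \<exists>b\<in>I. le a b \<and> b \<noteq> a)"

definition net_converges ::
  "'b topology \<Rightarrow> 'i set \<Rightarrow> ('i \<Rightarrow> 'i \<Rightarrow> bool) \<Rightarrow> ('i \<Rightarrow> 'b) \<Rightarrow> 'b \<Rightarrow> bool" where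
  "net_converges T I le x l \<longleftrightarrow>
     l \<in> topspace T \<and>
     (\<forall>U. openin T U \<and> l \<in> U \<longrightarrow> (\<exists>a\<in>I. \<forall>b\<in>I. le a b \<longrightarrow> x b \<in> U))"

section \<open>Charges\<close>

text \<open>A field of subsets of \<open>X\<close> is the library's \<^term>\<open>algebra X M\<close>.  Charges are taken to be
  extensional, so that two charges are equal iff they agree on the field.\<close>

definition charges :: "'a set \<Rightarrow> 'a set set \<Rightarrow> ('a set \<Rightarrow> real) set" where
  "charges X M = {\<mu> \<in> M \<rightarrow>\<^sub>E {0..1}. additive M \<mu> \<and> \<mu> X = 1}"

section \<open>Games with finitely additive strategies\<close>

type_synonym 'a profile = "nat \<Rightarrow> 'a set \<Rightarrow> real"

text \<open>The rectangle with sides \<open>R i\<close> is handled through the family \<open>R\<close>.  Only the empty rectangle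
  comes from several families, and each of these has an empty side, so its probability is \<open>0\<close>
  for all of them.  A list of pairs \<open>(c, R)\<close> represents the simple function
  \<open>\<Sum> c * indicator (\<Pi>\<^sub>E i\<in>{1..n}. R i)\<close>.\<close>

definition simple_fun ::
  "nat \<Rightarrow> (real \<times> (nat \<Rightarrow> 'a set)) list \<Rightarrow> (nat \<Rightarrow> 'a) \<Rightarrow> real" where
  "simple_fun n s a = (\<Sum>(c, R)\<leftarrow>s. c * indicator (\<Pi>\<^sub>E i\<in>{1..n}. R i) a)"

definition rect_prob :: "nat \<Rightarrow> 'a profile \<Rightarrow> (nat \<Rightarrow> 'a set) \<Rightarrow> real" where
  "rect_prob n \<kappa> R = (\<Prod>i\<in>{1..n}. \<kappa> i (R i))"

definition simple_expectation ::
  "nat \<Rightarrow> 'a profile \<Rightarrow> (real \<times> (nat \<Rightarrow> 'a set)) list \<Rightarrow> real" where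
  "simple_expectation n \<kappa> s = (\<Sum>(c, R)\<leftarrow>s. c * rect_prob n \<kappa> R)"

definition rectangles :: "nat \<Rightarrow> (nat \<Rightarrow> 'a set set) \<Rightarrow> (nat \<Rightarrow> 'a set) set" where
  "rectangles n F = (\<Pi>\<^sub>E i\<in>{1..n}. F i)"

definition simple_reps ::
  "nat \<Rightarrow> (nat \<Rightarrow> 'a set set) \<Rightarrow> (real \<times> (nat \<Rightarrow> 'a set)) list set" where
  "simple_reps n F = lists (UNIV \<times> rectangles n F)"

text \<open>The action sets are subsets of one type, which is no restriction because one may take
  a disjoint union.\<close>

locale fa_game =
  fixes n :: nat
    and A :: "nat \<Rightarrow> 'a set"
    and F :: "nat \<Rightarrow> 'a set set"
    and u :: "nat \<Rightarrow> (nat \<Rightarrow> 'a) \<Rightarrow> real"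
  assumes players: "n \<ge> 1"
    and actions_nonempty: "\<And>i. i \<in> {1..n} \<Longrightarrow> A i \<noteq> {}"
    and field: "\<And>i. i \<in> {1..n} \<Longrightarrow> algebra (A i) (F i)"
    and singletons: "\<And>i a. i \<in> {1..n} \<Longrightarrow> a \<in> A i \<Longrightarrow> {a} \<in> F i"
    and payoff_bounded: "\<And>i. i \<in> {1..n} \<Longrightarrow> bounded (u i ` (\<Pi>\<^sub>E j\<in>{1..n}. A j))"
    and payoff_uniform_limit: "\<And>i. i \<in> {1..n} \<Longrightarrow>
      \<exists>s. (\<forall>k::nat. s k \<in> simple_reps n F) \<and>
          uniform_limit (\<Pi>\<^sub>E j\<in>{1..n}. A j) (\<lambda>k. simple_fun n (s k)) (u i) sequentially"
begin

definition strategies :: "nat \<Rightarrow> ('a set \<Rightarrow> real) set" where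
  "strategies i = charges (A i) (F i)"

definition profiles :: "'a profile set" where
  "profiles = (\<Pi>\<^sub>E i\<in>{1..n}. strategies i)"

text \<open>The supremum of \<open>\<kappa>(f)\<close> over the simple functions \<open>f \<le> u\<^sub>i\<close>; \<open>f\<close> runs through its
  representations, on which \<open>\<kappa>(f)\<close> does not depend.\<close>

definition payoff :: "nat \<Rightarrow> 'a profile \<Rightarrow> real" where
  "payoff i \<kappa> = Sup {simple_expectation n \<kappa> s | s.
     s \<in> simple_reps n F \<and> (\<forall>a \<in> (\<Pi>\<^sub>E j\<in>{1..n}. A j). simple_fun n s a \<le> u i a)}"

definition tychonov :: "'a profile topology" where
  "tychonov = topology_generated_by
     {{\<tau> \<in> profiles. \<forall>R\<in>\<R>. \<bar>rect_prob n \<kappa> R - rect_prob n \<tau> R\<bar> < \<epsilon>} | \<kappa> \<epsilon> \<R>.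
       \<kappa> \<in> profiles \<and> \<epsilon> > 0 \<and> finite \<R> \<and> \<R> \<subseteq> rectangles n F}"

text \<open>The argument \<open>S\<close> gives the strategies the players may choose from: \<^term>\<open>strategies\<close> for the
  game itself, \<open>perturbed \<tau> \<epsilon>\<close> (below) for its perturbations.\<close>

definition best_response ::
  "(nat \<Rightarrow> ('a set \<Rightarrow> real) set) \<Rightarrow> 'a profile \<Rightarrow> 'a profile \<Rightarrow> bool" where
  "best_response S \<tau> \<sigma> \<longleftrightarrow>
     \<tau> \<in> (\<Pi>\<^sub>E i\<in>{1..n}. S i) \<and>
     (\<forall>i\<in>{1..n}. \<forall>t\<in>S i. payoff i (\<sigma>(i := \<tau> i)) \<ge> payoff i (\<sigma>(i := t)))"

definition nash :: "(nat \<Rightarrow> ('a set \<Rightarrow> real) set) \<Rightarrow> 'a profile \<Rightarrow> bool" where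
  "nash S \<sigma> \<longleftrightarrow> best_response S \<sigma> \<sigma>"

definition carrier_strategy :: "nat \<Rightarrow> ('a set \<Rightarrow> real) \<Rightarrow> 'a set set" where
  "carrier_strategy i \<mu> = {E \<in> F i. \<mu> E > 0}"

definition carrier_profile :: "'a profile \<Rightarrow> (nat \<Rightarrow> 'a set) set" where
  "carrier_profile \<sigma> = (\<Pi>\<^sub>E i\<in>{1..n}. carrier_strategy i (\<sigma> i))"

definition maximal_carrier :: "'a profile \<Rightarrow> bool" where
  "maximal_carrier \<sigma> \<longleftrightarrow> (\<forall>i\<in>{1..n}. carrier_strategy i (\<sigma> i) = F i - {{}})"

definition completely_mixed ::
  "'i set \<Rightarrow> ('i \<Rightarrow> 'i \<Rightarrow> bool) \<Rightarrow> ('i \<Rightarrow> 'a profile) \<Rightarrow> bool" where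
  "completely_mixed I le s \<longleftrightarrow>
     (\<forall>C \<in> carrier_profile ` profiles. \<exists>a\<in>I. \<forall>b\<in>I. le a b \<longrightarrow> C \<subseteq> carrier_profile (s b))"

definition perfect_along ::
  "'i set \<Rightarrow> ('i \<Rightarrow> 'i \<Rightarrow> bool) \<Rightarrow> ('i \<Rightarrow> 'a profile) \<Rightarrow> ('i \<Rightarrow> 'a profile) \<Rightarrow> 'a profile \<Rightarrow> bool"
  where
  "perfect_along I le s k \<sigma> \<longleftrightarrow>
     directed_set I le \<and> s \<in> I \<rightarrow> profiles \<and> k \<in> I \<rightarrow> profiles \<and>
     completely_mixed I le s \<and>
     net_converges tychonov I le s \<sigma> \<and> net_converges tychonov I le k \<sigma> \<and>
     (\<forall>a\<in>I. best_response strategies (k a) (s a))"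

text \<open>HOL cannot quantify over the type of the index set.  The type chosen here is large enough
  to express existence of a net over any index type: see \<open>perfect_along_imp_perfect\<close> below.\<close>

definition perfect :: "'a profile \<Rightarrow> bool" where
  "perfect \<sigma> \<longleftrightarrow> \<sigma> \<in> profiles \<and>
     (\<exists>(I :: (('a profile \<times> 'a profile) set \<times> nat) set) le s k. perfect_along I le s k \<sigma>)"

definition perfect_equilibrium :: "'a profile \<Rightarrow> bool" where
  "perfect_equilibrium \<sigma> \<longleftrightarrow> nash strategies \<sigma> \<and> perfect \<sigma>"

definition perturbed :: "'a profile \<Rightarrow> (nat \<Rightarrow> real) \<Rightarrow> nat \<Rightarrow> ('a set \<Rightarrow> real) set" where
  "perturbed \<tau> \<epsilon> i = {\<lambda>E\<in>F i. (1 - \<epsilon> i) * \<mu> E + \<epsilon> i * \<tau> i E | \<mu>. \<mu> \<in> strategies i}"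

definition M_perfect :: "'a profile \<Rightarrow> bool" where
  "M_perfect \<kappa> \<longleftrightarrow> nash strategies \<kappa> \<and>
     (\<forall>U \<eta>. openin tychonov U \<and> \<kappa> \<in> U \<and> \<eta> > 0 \<longrightarrow>
       (\<exists>\<epsilon> \<tau>. (\<forall>i\<in>{1..n}. \<epsilon> i > 0) \<and> L2_set \<epsilon> {1..n} < \<eta> \<and>
              \<tau> \<in> profiles \<and> maximal_carrier \<tau> \<and>
              (\<exists>\<sigma>\<in>U. nash (perturbed \<tau> \<epsilon>) \<sigma>)))"

lemma topspace_tychonov: "topspace tychonov = profiles"
proof -
  have "\<kappa> \<in> topspace tychonov" if "\<kappa> \<in> profiles" for \<kappa>
  proof -
    have "{\<tau> \<in> profiles. \<forall>R\<in>{}. \<bar>rect_prob n \<kappa> R - rect_prob n \<tau> R\<bar> < 1} \<in>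
      {{\<tau> \<in> profiles. \<forall>R\<in>\<R>. \<bar>rect_prob n \<kappa> R - rect_prob n \<tau> R\<bar> < \<epsilon>} | \<kappa> \<epsilon> \<R>.
       \<kappa> \<in> profiles \<and> \<epsilon> > 0 \<and> finite \<R> \<and> \<R> \<subseteq> rectangles n F}"
      using that zero_less_one by blast
    then show ?thesis
      unfolding tychonov_def topology_generated_by_topspace using that by blast
  qed
  then show ?thesis
    unfolding tychonov_def topology_generated_by_topspace by blast
qed

text \<open>A net over an arbitrary index type can be replaced by one indexed by its tails.  The natural
  number in the index keeps the directed set free of maximal elements.\<close>

lemma perfect_along_imp_perfect:
  fixes I :: "'i set"
  assumes "perfect_along I le s k \<sigma>"
  shows "perfect \<sigma>"
proof -
  define T where "T a = {(s b, k b) | b. b \<in> I \<and> le a b}" for a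
  define J where "J = T ` I \<times> (UNIV :: nat set)"
  define le' where "le' p q \<longleftrightarrow> fst q \<subseteq> fst p \<and> snd p \<le> snd q"
    for p q :: "('a profile \<times> 'a profile) set \<times> nat"
  define pick where "pick p = (SOME x. x \<in> fst p)"
    for p :: "('a profile \<times> 'a profile) set \<times> nat"
  have dir: "directed_set I le"
    using assms by (simp add: perfect_along_def)
  have ref: "a \<in> I \<Longrightarrow> le a a" for a
    using dir by (simp add: directed_set_def)
  have tr: "\<lbrakk>a \<in> I; b \<in> I; c \<in> I; le a b; le b c\<rbrakk> \<Longrightarrow> le a c" for a b c
    using dir unfolding directed_set_def by blast
  have T_ne: "a \<in> I \<Longrightarrow> (s a, k a) \<in> T a" for a
    using ref by (auto simp: T_def)
  have T_mono: "T b \<subseteq> T a" if "a \<in> I" "b \<in> I" "le a b" for a b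
    using tr that unfolding T_def by blast
  have pick_T: "pick p \<in> fst p" if "p \<in> J" for p
  proof -
    have "\<exists>x. x \<in> fst p"
      using that T_ne by (fastforce simp: J_def)
    then show ?thesis
      unfolding pick_def by (rule someI_ex)
  qed
  have pick_ex: "\<exists>b\<in>I. fst (pick p) = s b \<and> snd (pick p) = k b" if "p \<in> J" for p
  proof -
    obtain a where "a \<in> I" "fst p = T a"
      using \<open>p \<in> J\<close> by (auto simp: J_def)
    then show ?thesis
      using pick_T[OF that] by (auto simp: T_def)
  qed
  have ev: "\<exists>p\<in>J. \<forall>q\<in>J. le' p q \<longrightarrow> P (fst (pick q)) (snd (pick q))"
    if *: "\<exists>a\<in>I. \<forall>b\<in>I. le a b \<longrightarrow> P (s b) (k b)" for P
  proof -
    obtain a where a: "a \<in> I" "\<And>b. b \<in> I \<Longrightarrow> le a b \<Longrightarrow> P (s b) (k b)"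
      using * by blast
    have "P (fst (pick q)) (snd (pick q))" if "q \<in> J" "le' (T a, 0) q" for q
      using pick_T[OF that(1)] that(2) a by (auto simp: T_def le'_def)
    moreover have "(T a, 0) \<in> J"
      using a by (simp add: J_def)
    ultimately show ?thesis by blast
  qed
  have dJ: "directed_set J le'"
    unfolding directed_set_def
  proof (intro conjI ballI impI)
    show "J \<noteq> {}"
      using dir by (auto simp: J_def directed_set_def)
  next
    fix p q assume "p \<in> J" "q \<in> J"
    then obtain a b where ab: "a \<in> I" "fst p = T a" "b \<in> I" "fst q = T b"
      by (auto simp: J_def)
    then obtain c where c: "c \<in> I" "le a c" "le b c"
      using dir unfolding directed_set_def by blast
    show "\<exists>r\<in>J. le' p r \<and> le' q r"
      using ab c T_mono
      by (intro bexI[of _ "(T c, max (snd p) (snd q))"]) (auto simp: le'_def J_def)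
  next
    fix p assume "p \<in> J"
    then show "\<exists>q\<in>J. le' p q \<and> q \<noteq> p"
      by (intro bexI[of _ "(fst p, Suc (snd p))"]) (auto simp: le'_def J_def prod_eq_iff)
  qed (auto simp: le'_def)
  have "perfect_along J le' (\<lambda>p. fst (pick p)) (\<lambda>p. snd (pick p)) \<sigma>"
    unfolding perfect_along_def
  proof (intro conjI)
    show "(\<lambda>p. fst (pick p)) \<in> J \<rightarrow> profiles" "(\<lambda>p. snd (pick p)) \<in> J \<rightarrow> profiles"
      using pick_ex assms by (fastforce simp: perfect_along_def Pi_iff)+
    show "completely_mixed J le' (\<lambda>p. fst (pick p))"
      unfolding completely_mixed_def
    proof
      fix C assume "C \<in> carrier_profile ` profiles"
      then have "\<exists>a\<in>I. \<forall>b\<in>I. le a b \<longrightarrow> C \<subseteq> carrier_profile (s b)"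
        using assms unfolding perfect_along_def completely_mixed_def by blast
      then show "\<exists>p\<in>J. \<forall>q\<in>J. le' p q \<longrightarrow> C \<subseteq> carrier_profile (fst (pick q))"
        by (rule ev[of "\<lambda>x y. C \<subseteq> carrier_profile x"])
    qed
    show "net_converges tychonov J le' (\<lambda>p. fst (pick p)) \<sigma>"
      unfolding net_converges_def
    proof (intro conjI allI impI)
      show "\<sigma> \<in> topspace tychonov"
        using assms by (simp add: perfect_along_def net_converges_def)
      fix U assume "openin tychonov U \<and> \<sigma> \<in> U"
      then have "\<exists>a\<in>I. \<forall>b\<in>I. le a b \<longrightarrow> s b \<in> U"
        using assms unfolding perfect_along_def net_converges_def by blast
      then show "\<exists>p\<in>J. \<forall>q\<in>J. le' p q \<longrightarrow> fst (pick q) \<in> U"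
        by (rule ev[of "\<lambda>x y. x \<in> U"])
    qed
    show "net_converges tychonov J le' (\<lambda>p. snd (pick p)) \<sigma>"
      unfolding net_converges_def
    proof (intro conjI allI impI)
      show "\<sigma> \<in> topspace tychonov"
        using assms by (simp add: perfect_along_def net_converges_def)
      fix U assume "openin tychonov U \<and> \<sigma> \<in> U"
      then have "\<exists>a\<in>I. \<forall>b\<in>I. le a b \<longrightarrow> k b \<in> U"
        using assms unfolding perfect_along_def net_converges_def by blast
      then show "\<exists>p\<in>J. \<forall>q\<in>J. le' p q \<longrightarrow> snd (pick q) \<in> U"
        by (rule ev[of "\<lambda>x y. y \<in> U"])
    qed
    show "\<forall>p\<in>J. best_response strategies (snd (pick p)) (fst (pick p))"
      using pick_ex assms unfolding perfect_along_def by metis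
  qed (rule dJ)
  moreover have "\<sigma> \<in> profiles"
    using assms by (simp add: perfect_along_def net_converges_def topspace_tychonov)
  ultimately show ?thesis
    unfolding perfect_def by blast
qed

end

end

theory Submission
  imports Defs
begin

text \<open>An equilibrium \<open>\<sigma>\<close> of a perturbed game \<open>\<Gamma>(\<tau>, \<epsilon>)\<close> has the form
  \<open>\<sigma>\<^sub>i = (1 - \<epsilon>\<^sub>i) \<mu>\<^sub>i + \<epsilon>\<^sub>i \<tau>\<^sub>i\<close>.  It has maximal carrier because \<open>\<tau>\<close> does, \<open>\<mu>\<close> is a best response
  to \<open>\<sigma>\<close> in \<open>\<Gamma>\<close> because payoffs are affine in each coordinate, and \<open>\<mu>\<close> is uniformly close to \<open>\<sigma>\<close> on
  rectangles.  Indexing such pairs by the neighbourhoods of the M-perfect equilibrium together with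
  a bound on \<open>\<epsilon>\<close> gives the two nets.  For affinity of the payoff one needs expectations of simple
  functions to be monotone; this holds because on finitely many sets every charge agrees with a
  finitely supported one.\<close>

section \<open>Charges restricted to finitely many sets\<close>

lemma charges_empty:
  assumes "algebra X M" "\<mu> \<in> charges X M"
  shows "\<mu> {} = 0"
proof -
  interpret algebra X M by fact
  have "\<mu> ({} \<union> {}) = \<mu> {} + \<mu> {}"
    using assms(2) by (intro additiveD[of M]) (auto simp: charges_def)
  then show ?thesis by simp
qed

lemma charge_UN_disjoint:
  assumes "algebra X M" "\<mu> \<in> charges X M" "finite S" "\<And>i. i \<in> S \<Longrightarrow> E i \<in> M"
    "disjoint_family_on E S"
  shows "\<mu> (\<Union>i\<in>S. E i) = (\<Sum>i\<in>S. \<mu> (E i))"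
  using assms(3-5)
proof (induction S rule: finite_induct)
  case empty
  then show ?case using charges_empty[OF assms(1,2)] by simp
next
  case (insert j S)
  interpret algebra X M by fact
  have "E j \<inter> (\<Union>i\<in>S. E i) = {}"
    using insert by (auto simp: disjoint_family_on_def)
  moreover have "(\<Union>i\<in>S. E i) \<in> M"
    using insert by (intro finite_UN) auto
  ultimately have "\<mu> (E j \<union> (\<Union>i\<in>S. E i)) = \<mu> (E j) + \<mu> (\<Union>i\<in>S. E i)"
    using assms(2) insert.prems by (intro additiveD[of M]) (auto simp: charges_def)
  moreover have "disjoint_family_on E S"
    using insert.prems by (auto simp: disjoint_family_on_def)
  ultimately show ?case
    using insert by simp
qed

text \<open>The sets in \<open>\<R>\<close> cut \<open>X\<close> into finitely many cells, all of
  them in \<open>M\<close>. Moving the mass of each cell to one point of it changes no value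
  \<open>\<mu> R\<close>, since each \<open>R\<close> is a disjoint union of cells.\<close>

lemma charge_finite_support:
  assumes "algebra X M" and \<mu>: "\<mu> \<in> charges X M" and "finite \<R>" "\<R> \<subseteq> M"
  obtains P w where "finite P" "P \<subseteq> X" "\<And>p. p \<in> P \<Longrightarrow> 0 \<le> w p"
    "\<And>R. R \<in> \<R> \<Longrightarrow> \<mu> R = (\<Sum>p\<in>P. w p * indicator R p)"
proof -
  interpret algebra X M by fact
  \<comment> \<open>Points with equal \<open>sig\<close> belong to the same members of
    \<open>\<R>\<close>. \<open>P\<close> picks one representative per class, and
    \<open>cell p\<close> is the class of \<open>p\<close>.\<close>
  define sig where "sig a = {R \<in> \<R>. a \<in> R}" for a
  define P where "P = inv_into X sig ` sig ` X"
  define cell where "cell p = {a \<in> X. sig a = sig p}" for p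
  have "sig ` X \<subseteq> Pow \<R>"
    by (auto simp: sig_def)
  then have finP: "finite P"
    unfolding P_def using \<open>finite \<R>\<close> by (meson finite_Pow_iff finite_imageI finite_subset)
  have PX: "P \<subseteq> X"
    unfolding P_def by (auto intro: inv_into_into)
  have P_inv: "inv_into X sig (sig p) = p" if "p \<in> P" for p
    using that unfolding P_def by (auto simp: f_inv_into_f)
  have cell_M: "cell p \<in> M" for p
  proof -
    have "cell p = {a \<in> X. \<forall>R\<in>\<R>. a \<in> R \<longleftrightarrow> p \<in> R}"
      by (auto simp: cell_def sig_def)
    also have "\<dots> \<in> M"
    proof (rule sets_Collect_finite_All[OF _ \<open>finite \<R>\<close>])
      fix R assume "R \<in> \<R>"
      then have "R \<in> M" using \<open>\<R> \<subseteq> M\<close> by blast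
      moreover have "{a \<in> X. a \<in> R \<longleftrightarrow> p \<in> R} = (if p \<in> R then R else X - R)"
        using sets_into_space[OF \<open>R \<in> M\<close>] by auto
      ultimately show "{a \<in> X. a \<in> R \<longleftrightarrow> p \<in> R} \<in> M"
        by auto
    qed
    finally show ?thesis .
  qed
  have disj: "disjoint_family_on cell P"
    unfolding disjoint_family_on_def
  proof (intro ballI impI)
    fix p q assume "p \<in> P" "q \<in> P" "p \<noteq> q"
    then have "sig p \<noteq> sig q" using P_inv by metis
    then show "cell p \<inter> cell q = {}" by (auto simp: cell_def)
  qed
  have "\<mu> R = (\<Sum>p\<in>P. \<mu> (cell p) * indicator R p)" if "R \<in> \<R>" for R
  proof -
    have "R \<subseteq> X" using that \<open>\<R> \<subseteq> M\<close> sets_into_space by blast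
    \<comment> \<open>A cell lies inside \<open>R\<close> exactly when its representative
      does.\<close>
    have "(\<Union>p\<in>P \<inter> R. cell p) = R"
    proof (intro equalityI subsetI)
      fix a assume "a \<in> (\<Union>p\<in>P \<inter> R. cell p)"
      then show "a \<in> R" using that by (auto simp: cell_def sig_def)
    next
      fix a assume "a \<in> R"
      then have "a \<in> X" using \<open>R \<subseteq> X\<close> by blast
      define p where "p = inv_into X sig (sig a)"
      have "sig p = sig a"
        unfolding p_def by (rule f_inv_into_f) (use \<open>a \<in> X\<close> in blast)
      moreover have "p \<in> P"
        using \<open>a \<in> X\<close> by (auto simp: p_def P_def)
      moreover from \<open>sig p = sig a\<close> have "p \<in> R"
        using \<open>a \<in> R\<close> that by (auto simp: sig_def)
      ultimately show "a \<in> (\<Union>p\<in>P \<inter> R. cell p)"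
        using \<open>a \<in> X\<close> by (auto simp: cell_def)
    qed
    moreover have "\<mu> (\<Union>p\<in>P \<inter> R. cell p) = (\<Sum>p\<in>P \<inter> R. \<mu> (cell p))"
      using finP cell_M disj
      by (intro charge_UN_disjoint[OF assms(1) \<mu>]) (auto simp: disjoint_family_on_def)
    moreover have "(\<Sum>p\<in>P. \<mu> (cell p) * indicator R p) = (\<Sum>p\<in>P \<inter> R. \<mu> (cell p))"
      using finP by (simp add: indicator_def sum.inter_restrict if_distrib cong: if_cong)
    ultimately show ?thesis by simp
  qed
  moreover have "0 \<le> \<mu> (cell p)" for p
    using \<mu> cell_M by (auto simp: charges_def)
  ultimately show thesis
    by (intro that[OF finP PX])
qed

lemma prod_indicator_PiE:
  assumes "finite I" "p \<in> extensional I"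
  shows "(\<Prod>i\<in>I. indicator (R i) (p i)) = (indicator (Pi\<^sub>E I R) p :: real)"
proof (cases "\<forall>i\<in>I. p i \<in> R i")
  case True
  then show ?thesis using assms by (auto simp: PiE_iff)
next
  case False
  then obtain i where i: "i \<in> I" "p i \<notin> R i" by blast
  then have "(\<Prod>i\<in>I. indicator (R i) (p i)) = (0 :: real)"
    using assms by (intro prod_zero) (auto intro!: bexI[of _ i])
  with False show ?thesis by (auto simp: PiE_iff)
qed

context fa_game
begin

section \<open>Expectations of simple functions\<close>

lemma profile_charges: "\<kappa> \<in> profiles \<Longrightarrow> i \<in> {1..n} \<Longrightarrow> \<kappa> i \<in> charges (A i) (F i)"
  by (auto simp: profiles_def strategies_def)

lemma full_rectangle: "restrict A {1..n} \<in> rectangles n F"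
proof -
  have "A i \<in> F i" if "i \<in> {1..n}" for i
    using algebra.top[OF field[OF that]] .
  then show ?thesis by (auto simp: rectangles_def)
qed

lemma rect_prob_full: "\<kappa> \<in> profiles \<Longrightarrow> rect_prob n \<kappa> (restrict A {1..n}) = 1"
  unfolding rect_prob_def using profile_charges by (intro prod.neutral) (auto simp: charges_def)

lemma rectangles_side: "R \<in> rectangles n F \<Longrightarrow> i \<in> {1..n} \<Longrightarrow> R i \<in> F i"
  unfolding rectangles_def by (rule PiE_mem)

text \<open>Each coordinate is replaced by a finitely supported charge agreeing with it on the
  relevant sides; the product of these has weights \<open>W\<close> and reproduces
  \<open>rect_prob\<close> on \<open>\<R>\<close>.\<close>

lemma profile_finite_support:
  assumes \<kappa>: "\<kappa> \<in> profiles" and "finite \<R>" "\<R> \<subseteq> rectangles n F"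
  obtains P W where "finite P" "P \<subseteq> (\<Pi>\<^sub>E i\<in>{1..n}. A i)" "\<And>p. p \<in> P \<Longrightarrow> 0 \<le> W p"
    "sum W P = 1"
    "\<And>R. R \<in> \<R> \<Longrightarrow> rect_prob n \<kappa> R = (\<Sum>p\<in>P. W p * indicator (\<Pi>\<^sub>E i\<in>{1..n}. R i) p)"
proof -
  \<comment> \<open>Adjoining the full rectangle makes the total weight computable: its probability
    is 1.\<close>
  define \<R>' where "\<R>' = insert (restrict A {1..n}) \<R>"
  have \<R>': "finite \<R>'" "\<R>' \<subseteq> rectangles n F"
    using assms full_rectangle by (auto simp: \<R>'_def)
  define good where "good i P w \<longleftrightarrow> finite P \<and> P \<subseteq> A i \<and> (\<forall>p\<in>P. 0 \<le> w p) \<and>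
      (\<forall>R\<in>\<R>'. \<kappa> i (R i) = (\<Sum>p\<in>P. w p * indicator (R i) p))" for i P and w :: "'a \<Rightarrow> real"
  have "\<exists>P w. good i P w" if i: "i \<in> {1..n}" for i
  proof -
    have "(\<lambda>R. R i) ` \<R>' \<subseteq> F i"
      using \<R>' rectangles_side[OF _ i] by blast
    with charge_finite_support[OF field[OF i] profile_charges[OF \<kappa> i], of "(\<lambda>R. R i) ` \<R>'"] \<R>'
    obtain P w where "finite P" "P \<subseteq> A i" "\<And>p. p \<in> P \<Longrightarrow> 0 \<le> w p"
      "\<And>R. R \<in> (\<lambda>R. R i) ` \<R>' \<Longrightarrow> \<kappa> i R = (\<Sum>p\<in>P. w p * indicator R p)"
      by blast
    then have "good i P w"
      by (auto simp: good_def)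
    then show ?thesis by blast
  qed
  then obtain P w where "\<And>i. i \<in> {1..n} \<Longrightarrow> good i (P i) (w i)"
    by metis
  note Pw = this[unfolded good_def]
  define Q where "Q = (\<Pi>\<^sub>E i\<in>{1..n}. P i)"
  define W where "W p = (\<Prod>i\<in>{1..n}. w i (p i))" for p
  have QA: "Q \<subseteq> (\<Pi>\<^sub>E i\<in>{1..n}. A i)"
    unfolding Q_def using Pw by (intro PiE_mono) blast
  have eq: "rect_prob n \<kappa> R = (\<Sum>p\<in>Q. W p * indicator (\<Pi>\<^sub>E i\<in>{1..n}. R i) p)" if "R \<in> \<R>'" for R
  proof -
    have "rect_prob n \<kappa> R = (\<Prod>i\<in>{1..n}. \<Sum>p\<in>P i. w i p * indicator (R i) p)"
      unfolding rect_prob_def using Pw that by (intro prod.cong) blast+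
    \<comment> \<open>Multiplying out a product of finite sums gives a sum over all choice
      functions, that is, over the finite product \<open>Q\<close>.\<close>
    also have "\<dots> = (\<Sum>p\<in>Q. \<Prod>i\<in>{1..n}. w i (p i) * indicator (R i) (p i))"
      unfolding Q_def using Pw by (intro prod_sum_PiE) auto
    also have "\<dots> = (\<Sum>p\<in>Q. W p * indicator (\<Pi>\<^sub>E i\<in>{1..n}. R i) p)"
    proof (rule sum.cong[OF refl])
      fix p assume "p \<in> Q"
      then have "p \<in> extensional {1..n}" by (auto simp: Q_def PiE_def)
      then show "(\<Prod>i\<in>{1..n}. w i (p i) * indicator (R i) (p i)) =
          W p * indicator (\<Pi>\<^sub>E i\<in>{1..n}. R i) p"
        by (simp add: prod.distrib W_def prod_indicator_PiE)
    qed
    finally show ?thesis .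
  qed
  have "1 = (\<Sum>p\<in>Q. W p * indicator (\<Pi>\<^sub>E i\<in>{1..n}. restrict A {1..n} i) p)"
    using eq[of "restrict A {1..n}"] rect_prob_full[OF \<kappa>] by (simp add: \<R>'_def)
  also have "\<dots> = sum W Q"
    using QA by (intro sum.cong) (auto simp: indicator_def PiE_iff subset_iff)
  finally have "sum W Q = 1" ..
  moreover have "finite Q"
    unfolding Q_def using Pw by (intro finite_PiE) auto
  moreover have "0 \<le> W p" if "p \<in> Q" for p
    unfolding W_def using Pw PiE_mem[OF that[unfolded Q_def]] by (intro prod_nonneg) blast
  ultimately show thesis
    using that QA eq by (auto simp: \<R>'_def)
qed

lemma simple_expectation_eq_sum:
  assumes "\<And>c R. (c, R) \<in> set s \<Longrightarrow>
    rect_prob n \<kappa> R = (\<Sum>p\<in>P. W p * indicator (\<Pi>\<^sub>E i\<in>{1..n}. R i) p)"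
  shows "simple_expectation n \<kappa> s = (\<Sum>p\<in>P. W p * simple_fun n s p)"
  using assms
proof (induction s)
  case Nil
  then show ?case by (simp add: simple_expectation_def simple_fun_def)
next
  case (Cons x s)
  obtain c R where x: "x = (c, R)" by fastforce
  have "simple_expectation n \<kappa> s = (\<Sum>p\<in>P. W p * simple_fun n s p)"
    by (rule Cons.IH) (use Cons.prems in auto)
  moreover have "rect_prob n \<kappa> R = (\<Sum>p\<in>P. W p * indicator (\<Pi>\<^sub>E i\<in>{1..n}. R i) p)"
    by (rule Cons.prems[of c]) (simp add: x)
  ultimately show ?case
    by (simp add: x simple_expectation_def simple_fun_def sum_distrib_left sum.distrib
        algebra_simps)
qed

text \<open>On the finitely many rectangles of \<open>s\<close> and \<open>t\<close>,
  \<open>\<kappa>\<close> acts as a finitely supported probability. Both expectations are then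
  averages of function values, and \<open>d\<close> survives unchanged because the weights sum to 1.
  For \<open>d = 0\<close> this is monotonicity, hence also independence of the
  representation.\<close>

lemma simple_expectation_le:
  assumes \<kappa>: "\<kappa> \<in> profiles" and s: "s \<in> simple_reps n F" and t: "t \<in> simple_reps n F"
    and le: "\<And>a. a \<in> (\<Pi>\<^sub>E i\<in>{1..n}. A i) \<Longrightarrow> simple_fun n s a \<le> simple_fun n t a + d"
  shows "simple_expectation n \<kappa> s \<le> simple_expectation n \<kappa> t + d"
proof -
  have fin: "finite (snd ` (set s \<union> set t))"
    and sub: "snd ` (set s \<union> set t) \<subseteq> rectangles n F"
    using s t by (auto simp: simple_reps_def lists_eq_set)
  obtain P W where PW: "finite P" "P \<subseteq> (\<Pi>\<^sub>E i\<in>{1..n}. A i)" "\<And>p. p \<in> P \<Longrightarrow> 0 \<le> W p"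
    "sum W P = 1"
    "\<And>R. R \<in> snd ` (set s \<union> set t) \<Longrightarrow>
      rect_prob n \<kappa> R = (\<Sum>p\<in>P. W p * indicator (\<Pi>\<^sub>E i\<in>{1..n}. R i) p)"
    by (rule profile_finite_support[OF \<kappa> fin sub]) blast
  have "simple_expectation n \<kappa> s = (\<Sum>p\<in>P. W p * simple_fun n s p)"
    by (intro simple_expectation_eq_sum PW(5)) force
  also have "\<dots> \<le> (\<Sum>p\<in>P. W p * (simple_fun n t p + d))"
    using PW le by (intro sum_mono mult_left_mono) auto
  also have "\<dots> = (\<Sum>p\<in>P. W p * simple_fun n t p) + d"
    by (simp add: distrib_left sum.distrib PW(4) flip: sum_distrib_right)
  also have "(\<Sum>p\<in>P. W p * simple_fun n t p) = simple_expectation n \<kappa> t"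
    by (intro simple_expectation_eq_sum[symmetric] PW(5)) force
  finally show ?thesis .
qed

section \<open>Payoffs as limits of simple expectations, and their affinity in each
  coordinate\<close>

text \<open>The supremum defining the payoff is sandwiched: \<open>s\<close> lowered by
  \<open>d\<close> is an admissible simple function, and every admissible one is at most
  \<open>s\<close> raised by \<open>d\<close>.\<close>

lemma payoff_approx:
  assumes \<kappa>: "\<kappa> \<in> profiles" and s: "s \<in> simple_reps n F"
    and close: "\<And>a. a \<in> (\<Pi>\<^sub>E j\<in>{1..n}. A j) \<Longrightarrow> \<bar>simple_fun n s a - u i a\<bar> \<le> d"
  shows "\<bar>simple_expectation n \<kappa> s - payoff i \<kappa>\<bar> \<le> d"
proof -
  define V where "V = {simple_expectation n \<kappa> t | t.
     t \<in> simple_reps n F \<and> (\<forall>a \<in> (\<Pi>\<^sub>E j\<in>{1..n}. A j). simple_fun n t a \<le> u i a)}"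
  have upper: "v \<le> simple_expectation n \<kappa> s + d" if "v \<in> V" for v
  proof -
    obtain t where t: "t \<in> simple_reps n F" "v = simple_expectation n \<kappa> t"
      "\<And>a. a \<in> (\<Pi>\<^sub>E j\<in>{1..n}. A j) \<Longrightarrow> simple_fun n t a \<le> u i a"
      using \<open>v \<in> V\<close> unfolding V_def by blast
    have "simple_fun n t a \<le> simple_fun n s a + d" if "a \<in> (\<Pi>\<^sub>E j\<in>{1..n}. A j)" for a
      using t(3)[OF that] close[OF that] by linarith
    then show ?thesis
      unfolding t(2) by (intro simple_expectation_le[OF \<kappa> t(1) s])
  qed
  have "simple_expectation n \<kappa> s - d \<in> V"
  proof -
    \<comment> \<open>The constant \<open>- d\<close> is written as a multiple of the indicator of
      the full rectangle.\<close>
    define t where "t = (- d, restrict A {1..n}) # s"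
    have "t \<in> simple_reps n F"
      using s full_rectangle by (simp add: t_def simple_reps_def)
    moreover have "simple_expectation n \<kappa> t = simple_expectation n \<kappa> s - d"
      using rect_prob_full[OF \<kappa>] by (simp add: t_def simple_expectation_def)
    moreover have "simple_fun n t a \<le> u i a" if a: "a \<in> (\<Pi>\<^sub>E j\<in>{1..n}. A j)" for a
    proof -
      have "a \<in> (\<Pi>\<^sub>E j\<in>{1..n}. restrict A {1..n} j)"
        using a by (auto simp: PiE_iff)
      then have "simple_fun n t a = simple_fun n s a - d"
        unfolding t_def simple_fun_def by (simp del: restrict_apply atLeastAtMost_iff)
      then show ?thesis using close[OF a] by linarith
    qed
    ultimately show ?thesis
      unfolding V_def by (intro CollectI exI[of _ t]) auto
  qed
  moreover from this upper have "Sup V \<le> simple_expectation n \<kappa> s + d"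
    by (intro cSup_least) auto
  moreover have "bdd_above V"
    using upper by (auto simp: bdd_above_def)
  ultimately have "simple_expectation n \<kappa> s - d \<le> Sup V" "Sup V \<le> simple_expectation n \<kappa> s + d"
    by (auto intro: cSup_upper)
  then show ?thesis
    unfolding payoff_def V_def[symmetric] by linarith
qed

lemma tendsto_payoff:
  assumes \<kappa>: "\<kappa> \<in> profiles" and s: "\<And>k. s k \<in> simple_reps n F"
    and lim: "uniform_limit (\<Pi>\<^sub>E j\<in>{1..n}. A j) (\<lambda>k. simple_fun n (s k)) (u i) sequentially"
  shows "(\<lambda>k. simple_expectation n \<kappa> (s k)) \<longlonglongrightarrow> payoff i \<kappa>"
proof (rule tendstoI)
  fix e :: real assume "e > 0"
  \<comment> \<open>Half of \<open>e\<close>, since \<open>payoff_approx\<close> yields only a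
    non-strict bound.\<close>
  then have "\<forall>\<^sub>F k in sequentially. \<forall>a\<in>(\<Pi>\<^sub>E j\<in>{1..n}. A j). dist (simple_fun n (s k) a) (u i a) < e / 2"
    using lim by (intro uniform_limitD) auto
  then show "\<forall>\<^sub>F k in sequentially. dist (simple_expectation n \<kappa> (s k)) (payoff i \<kappa>) < e"
  proof eventually_elim
    case (elim k)
    then have "\<bar>simple_expectation n \<kappa> (s k) - payoff i \<kappa>\<bar> \<le> e / 2"
      by (intro payoff_approx[OF \<kappa> s]) (auto simp: dist_real_def less_imp_le)
    with \<open>e > 0\<close> show ?case by (simp add: dist_real_def)
  qed
qed

lemma convex_combination_strategies:
  assumes i: "i \<in> {1..n}" and e: "0 \<le> e" "e \<le> 1"
    and \<mu>: "\<mu> \<in> strategies i" and \<nu>: "\<nu> \<in> strategies i"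
  shows "(\<lambda>E\<in>F i. (1 - e) * \<mu> E + e * \<nu> E) \<in> strategies i"
proof -
  interpret algebra "A i" "F i" by (rule field[OF i])
  have "(1 - e) * \<mu> E + e * \<nu> E \<in> {0..1}" if "E \<in> F i" for E
  proof -
    have "\<mu> E \<in> {0..1}" "\<nu> E \<in> {0..1}"
      using \<mu> \<nu> that by (auto simp: strategies_def charges_def)
    then show ?thesis
      using e convex_bound_le[of "\<mu> E" 1 "\<nu> E" "1 - e" e] by auto
  qed
  moreover have "additive (F i) (\<lambda>E\<in>F i. (1 - e) * \<mu> E + e * \<nu> E)"
    unfolding additive_def
  proof (intro ballI impI)
    fix x y assume xy: "x \<in> F i" "y \<in> F i" "x \<inter> y = {}"
    then have "\<mu> (x \<union> y) = \<mu> x + \<mu> y" "\<nu> (x \<union> y) = \<nu> x + \<nu> y"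
      using \<mu> \<nu> by (auto simp: strategies_def charges_def additive_def)
    with xy show "(\<lambda>E\<in>F i. (1 - e) * \<mu> E + e * \<nu> E) (x \<union> y) =
        (\<lambda>E\<in>F i. (1 - e) * \<mu> E + e * \<nu> E) x + (\<lambda>E\<in>F i. (1 - e) * \<mu> E + e * \<nu> E) y"
      by (simp add: Un algebra_simps)
  qed
  ultimately show ?thesis
    using \<mu> \<nu> by (auto simp: strategies_def charges_def)
qed

text \<open>Every rectangle probability is a product in which the strategy of player
  \<open>i\<close> enters through the single factor at \<open>R i\<close>.\<close>

lemma simple_expectation_affine:
  assumes i: "i \<in> {1..n}" and "s \<in> simple_reps n F"
  shows "simple_expectation n (\<sigma>(i := \<lambda>E\<in>F i. (1 - e) * \<mu> E + e * \<nu> E)) s =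
    (1 - e) * simple_expectation n (\<sigma>(i := \<mu>)) s + e * simple_expectation n (\<sigma>(i := \<nu>)) s"
proof -
  have prod_upd: "rect_prob n (\<sigma>(i := t)) R = t (R i) * (\<Prod>j\<in>{1..n} - {i}. \<sigma> j (R j))" for t R
  proof -
    have "rect_prob n (\<sigma>(i := t)) R = t (R i) * (\<Prod>j\<in>{1..n} - {i}. (\<sigma>(i := t)) j (R j))"
      unfolding rect_prob_def using i by (subst prod.remove[of _ i]) auto
    also have "(\<Prod>j\<in>{1..n} - {i}. (\<sigma>(i := t)) j (R j)) = (\<Prod>j\<in>{1..n} - {i}. \<sigma> j (R j))"
      by (intro prod.cong) auto
    finally show ?thesis .
  qed
  from assms(2) have "set s \<subseteq> UNIV \<times> rectangles n F"
    by (auto simp: simple_reps_def)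
  then show ?thesis
  proof (induction s)
    case Nil
    then show ?case by (simp add: simple_expectation_def)
  next
    case (Cons x s)
    obtain c R where x: "x = (c, R)" by fastforce
    then have "R i \<in> F i"
      using Cons.prems rectangles_side[OF _ i] by auto
    have expand: "simple_expectation n \<kappa> (x # s) = c * rect_prob n \<kappa> R + simple_expectation n \<kappa> s" for \<kappa>
      by (simp add: x simple_expectation_def)
    have IH: "simple_expectation n (\<sigma>(i := \<lambda>E\<in>F i. (1 - e) * \<mu> E + e * \<nu> E)) s =
        (1 - e) * simple_expectation n (\<sigma>(i := \<mu>)) s + e * simple_expectation n (\<sigma>(i := \<nu>)) s"
      by (rule Cons.IH) (use Cons.prems in auto)
    show ?case
      unfolding expand IH prod_upd restrict_apply'[OF \<open>R i \<in> F i\<close>] by (simp add: algebra_simps)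
  qed
qed

lemma profiles_upd:
  "\<sigma> \<in> profiles \<Longrightarrow> i \<in> {1..n} \<Longrightarrow> t \<in> strategies i \<Longrightarrow> \<sigma>(i := t) \<in> profiles"
  unfolding profiles_def by (auto simp: PiE_iff extensional_def)

text \<open>One approximating sequence for \<open>u i\<close> serves all three profiles, so the
  identity for simple functions passes to the limit.\<close>

lemma payoff_affine:
  assumes i: "i \<in> {1..n}" and \<sigma>: "\<sigma> \<in> profiles" and e: "0 \<le> e" "e \<le> 1"
    and \<mu>: "\<mu> \<in> strategies i" and \<nu>: "\<nu> \<in> strategies i"
  shows "payoff i (\<sigma>(i := \<lambda>E\<in>F i. (1 - e) * \<mu> E + e * \<nu> E)) =
    (1 - e) * payoff i (\<sigma>(i := \<mu>)) + e * payoff i (\<sigma>(i := \<nu>))"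
proof -
  obtain s where s: "\<And>k::nat. s k \<in> simple_reps n F"
    and lim: "uniform_limit (\<Pi>\<^sub>E j\<in>{1..n}. A j) (\<lambda>k. simple_fun n (s k)) (u i) sequentially"
    using payoff_uniform_limit[OF i] by blast
  have conv: "(\<lambda>k. simple_expectation n (\<sigma>(i := t)) (s k)) \<longlonglongrightarrow> payoff i (\<sigma>(i := t))"
    if "t \<in> strategies i" for t
    by (rule tendsto_payoff[OF profiles_upd[OF \<sigma> i that] s lim])
  have "(\<lambda>k. simple_expectation n (\<sigma>(i := \<lambda>E\<in>F i. (1 - e) * \<mu> E + e * \<nu> E)) (s k))
      \<longlonglongrightarrow> (1 - e) * payoff i (\<sigma>(i := \<mu>)) + e * payoff i (\<sigma>(i := \<nu>))"
    unfolding simple_expectation_affine[OF i s] by (intro tendsto_intros conv \<mu> \<nu>)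
  then show ?thesis
    using LIMSEQ_unique[OF conv[OF convex_combination_strategies[OF i e \<mu> \<nu>]]] by blast
qed

section \<open>Equilibria of perturbed games\<close>

text \<open>By affinity, playing the mixture built from \<open>t\<close> pays
  \<open>1 - \<epsilon> i\<close> times the payoff of \<open>t\<close> plus a term independent of
  \<open>t\<close>. As the factor is positive, an optimal mixture comes from an optimal unperturbed
  strategy.\<close>

lemma nash_perturbed_best_response:
  assumes nash: "nash (perturbed \<tau> \<epsilon>) \<sigma>" and \<tau>: "\<tau> \<in> profiles"
    and \<epsilon>: "\<And>i. i \<in> {1..n} \<Longrightarrow> 0 \<le> \<epsilon> i \<and> \<epsilon> i < 1"
  obtains \<mu> where "\<mu> \<in> profiles" "\<sigma> \<in> profiles" "best_response strategies \<mu> \<sigma>"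
    "\<And>i. i \<in> {1..n} \<Longrightarrow> \<sigma> i = (\<lambda>E\<in>F i. (1 - \<epsilon> i) * \<mu> i E + \<epsilon> i * \<tau> i E)"
proof -
  define mix where "mix i t = (\<lambda>E\<in>F i. (1 - \<epsilon> i) * t E + \<epsilon> i * \<tau> i E)" for i t
  have \<sigma>E: "\<sigma> \<in> (\<Pi>\<^sub>E i\<in>{1..n}. perturbed \<tau> \<epsilon> i)"
    and opt: "\<And>i t. i \<in> {1..n} \<Longrightarrow> t \<in> perturbed \<tau> \<epsilon> i \<Longrightarrow> payoff i (\<sigma>(i := t)) \<le> payoff i (\<sigma>(i := \<sigma> i))"
    using nash unfolding nash_def best_response_def by auto
  have pert: "t \<in> perturbed \<tau> \<epsilon> i \<longleftrightarrow> (\<exists>\<mu>\<in>strategies i. t = mix i \<mu>)" for i t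
    unfolding perturbed_def mix_def by blast
  have "\<exists>m\<in>strategies i. \<sigma> i = mix i m" if "i \<in> {1..n}" for i
    using \<sigma>E that pert by blast
  then obtain m where m: "\<And>i. i \<in> {1..n} \<Longrightarrow> m i \<in> strategies i \<and> \<sigma> i = mix i (m i)"
    by metis
  have \<tau>i: "\<tau> i \<in> strategies i" if "i \<in> {1..n}" for i
    using \<tau> that by (auto simp: profiles_def)
  have \<sigma>: "\<sigma> \<in> profiles"
    unfolding profiles_def
  proof (rule PiE_I)
    fix i assume i: "i \<in> {1..n}"
    show "\<sigma> i \<in> strategies i"
      using m[OF i] \<tau>i[OF i] \<epsilon>[OF i] convex_combination_strategies[OF i, of "\<epsilon> i" "m i" "\<tau> i"]
      by (simp add: mix_def)
  qed (use \<sigma>E in auto)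
  \<comment> \<open>Profiles are extensional, whereas \<open>m\<close> is arbitrary outside the
    player set.\<close>
  define \<mu> where "\<mu> = restrict m {1..n}"
  have \<mu>: "\<mu> \<in> profiles"
    using m by (auto simp: \<mu>_def profiles_def)
  have "payoff i (\<sigma>(i := t)) \<le> payoff i (\<sigma>(i := \<mu> i))" if i: "i \<in> {1..n}" and t: "t \<in> strategies i" for i t
  proof -
    have e: "0 \<le> \<epsilon> i" "\<epsilon> i \<le> 1" "\<epsilon> i < 1" using \<epsilon>[OF i] by auto
    have "\<mu> i = m i" using i by (simp add: \<mu>_def)
    have "payoff i (\<sigma>(i := mix i t)) \<le> payoff i (\<sigma>(i := mix i (m i)))"
      using opt[OF i, of "mix i t"] pert[of "mix i t" i] t m[OF i] by auto
    \<comment> \<open>Both sides expand affinely, and the common contribution of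
      \<open>\<tau> i\<close> cancels.\<close>
    then have "(1 - \<epsilon> i) * payoff i (\<sigma>(i := t)) \<le> (1 - \<epsilon> i) * payoff i (\<sigma>(i := m i))"
      using payoff_affine[OF i \<sigma> e(1,2) t \<tau>i[OF i]]
        payoff_affine[OF i \<sigma> e(1,2) conjunct1[OF m[OF i]] \<tau>i[OF i]]
      by (simp add: mix_def)
    with e(3) show ?thesis by (simp add: \<open>\<mu> i = m i\<close>)
  qed
  then have "best_response strategies \<mu> \<sigma>"
    unfolding best_response_def using \<mu> by (auto simp: profiles_def)
  with that \<mu> \<sigma> m show thesis
    by (auto simp: \<mu>_def mix_def)
qed

text \<open>Each factor moves by at most \<open>\<epsilon> i\<close>, and a product of numbers in
  the unit interval moves by at most the sum of the changes of its factors. The bound does not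
  depend on \<open>R\<close>.\<close>

lemma rect_prob_mix_diff:
  fixes \<eta> :: real and \<epsilon> :: "nat \<Rightarrow> real"
  assumes \<mu>: "\<mu> \<in> profiles" and \<sigma>: "\<sigma> \<in> profiles" and \<tau>: "\<tau> \<in> profiles"
    and eq: "\<And>i. i \<in> {1..n} \<Longrightarrow> \<sigma> i = (\<lambda>E\<in>F i. (1 - \<epsilon> i) * \<mu> i E + \<epsilon> i * \<tau> i E)"
    and \<epsilon>: "\<And>i. i \<in> {1..n} \<Longrightarrow> 0 \<le> \<epsilon> i \<and> \<epsilon> i \<le> \<eta>"
    and R: "R \<in> rectangles n F"
  shows "\<bar>rect_prob n \<sigma> R - rect_prob n \<mu> R\<bar> \<le> n * \<eta>"
proof -
  have unit: "\<kappa> i (R i) \<in> {0..1}" if "\<kappa> \<in> profiles" "i \<in> {1..n}" for \<kappa> i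
    using profile_charges[OF that] rectangles_side[OF R that(2)]
    unfolding charges_def by blast
  have le: "\<bar>\<sigma> i (R i) - \<mu> i (R i)\<bar> \<le> \<eta>" if i: "i \<in> {1..n}" for i
  proof -
    have "R i \<in> F i" by (rule rectangles_side[OF R i])
    then have "\<sigma> i (R i) - \<mu> i (R i) = \<epsilon> i * (\<tau> i (R i) - \<mu> i (R i))"
      by (simp add: eq[OF i] algebra_simps)
    then have "\<bar>\<sigma> i (R i) - \<mu> i (R i)\<bar> = \<epsilon> i * \<bar>\<tau> i (R i) - \<mu> i (R i)\<bar>"
      using \<epsilon>[OF i] by (simp add: abs_mult)
    also have "\<dots> \<le> \<epsilon> i * 1"
      using \<epsilon>[OF i] unit[OF \<tau> i] unit[OF \<mu> i] by (intro mult_left_mono) auto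
    finally show ?thesis using \<epsilon>[OF i] by simp
  qed
  have "norm (rect_prob n \<sigma> R - rect_prob n \<mu> R) \<le> (\<Sum>i\<in>{1..n}. norm (\<sigma> i (R i) - \<mu> i (R i)))"
    unfolding rect_prob_def using unit[OF \<sigma>] unit[OF \<mu>] by (intro norm_prod_diff) auto
  also have "\<dots> \<le> (\<Sum>i\<in>{1..n}. \<eta>)"
    using le by (intro sum_mono) simp
  finally show ?thesis by simp
qed

lemma maximal_carrier_mix:
  fixes \<epsilon> :: "nat \<Rightarrow> real"
  assumes \<mu>: "\<mu> \<in> profiles" and \<sigma>: "\<sigma> \<in> profiles" and max: "maximal_carrier \<tau>"
    and eq: "\<And>i. i \<in> {1..n} \<Longrightarrow> \<sigma> i = (\<lambda>E\<in>F i. (1 - \<epsilon> i) * \<mu> i E + \<epsilon> i * \<tau> i E)"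
    and \<epsilon>: "\<And>i. i \<in> {1..n} \<Longrightarrow> 0 < \<epsilon> i \<and> \<epsilon> i \<le> 1"
  shows "maximal_carrier \<sigma>"
  unfolding maximal_carrier_def
proof
  fix i assume i: "i \<in> {1..n}"
  have "\<sigma> i E > 0" if "E \<in> F i" "E \<noteq> {}" for E
  proof -
    have "E \<in> carrier_strategy i (\<tau> i)"
      using max i that by (auto simp: maximal_carrier_def)
    moreover have "\<mu> i E \<ge> 0"
      using profile_charges[OF \<mu> i] that by (auto simp: charges_def)
    ultimately show ?thesis
      using \<epsilon>[OF i] that by (auto simp: carrier_strategy_def eq[OF i] intro!: add_nonneg_pos)
  qed
  moreover have "\<sigma> i {} = 0"
    by (rule charges_empty[OF field[OF i] profile_charges[OF \<sigma> i]])
  ultimately show "carrier_strategy i (\<sigma> i) = F i - {{}}"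
    unfolding carrier_strategy_def by force
qed

text \<open>Every charge vanishes on the empty set, so no carrier exceeds the maximal one. A net of
  profiles with maximal carrier is therefore completely mixed.\<close>

lemma carrier_subset_maximal_carrier:
  assumes \<rho>: "\<rho> \<in> profiles" and max: "maximal_carrier \<sigma>"
  shows "carrier_profile \<rho> \<subseteq> carrier_profile \<sigma>"
proof -
  have "carrier_strategy i (\<rho> i) \<subseteq> carrier_strategy i (\<sigma> i)" if i: "i \<in> {1..n}" for i
  proof -
    have "carrier_strategy i (\<sigma> i) = F i - {{}}"
      using max i by (simp add: maximal_carrier_def)
    then show ?thesis
      using charges_empty[OF field[OF i] profile_charges[OF \<rho> i]]
      by (auto simp: carrier_strategy_def)
  qed
  then show ?thesis
    unfolding carrier_profile_def by (intro PiE_mono)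
qed

section \<open>Neighbourhoods in the Tychonov topology\<close>

definition basic_nhd :: "'a profile \<Rightarrow> real \<Rightarrow> (nat \<Rightarrow> 'a set) set \<Rightarrow> 'a profile set" where
  "basic_nhd \<kappa> \<epsilon> \<R> = {\<tau> \<in> profiles. \<forall>R\<in>\<R>. \<bar>rect_prob n \<kappa> R - rect_prob n \<tau> R\<bar> < \<epsilon>}"

lemma openin_basic_nhd:
  assumes "\<kappa> \<in> profiles" "\<epsilon> > 0" "finite \<R>" "\<R> \<subseteq> rectangles n F"
  shows "openin tychonov (basic_nhd \<kappa> \<epsilon> \<R>)"
  unfolding tychonov_def openin_topology_generated_by_iff basic_nhd_def
  by (rule generate_topology_on.Basis, rule CollectI,
      intro exI[of _ \<kappa>] exI[of _ \<epsilon>] exI[of _ \<R>] conjI refl assms)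

text \<open>The generators containing \<open>\<kappa>\<close> may be centred at other profiles, so
  they are recentred at \<open>\<kappa>\<close> with a smaller radius. Intersections use the smaller
  radius and the union of the rectangle sets.\<close>

lemma basic_nhd_subset_open:
  assumes "openin tychonov U" "\<kappa> \<in> U"
  obtains \<epsilon> \<R> where "\<epsilon> > 0" "finite \<R>" "\<R> \<subseteq> rectangles n F" "basic_nhd \<kappa> \<epsilon> \<R> \<subseteq> U"
proof -
  have "generate_topology_on {{\<tau> \<in> profiles. \<forall>R\<in>\<R>. \<bar>rect_prob n \<kappa> R - rect_prob n \<tau> R\<bar> < \<epsilon>} | \<kappa> \<epsilon> \<R>.
       \<kappa> \<in> profiles \<and> \<epsilon> > 0 \<and> finite \<R> \<and> \<R> \<subseteq> rectangles n F} U"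
    using assms(1) unfolding tychonov_def openin_topology_generated_by_iff .
  then have "\<exists>\<epsilon> \<R>. \<epsilon> > 0 \<and> finite \<R> \<and> \<R> \<subseteq> rectangles n F \<and> basic_nhd \<kappa> \<epsilon> \<R> \<subseteq> U"
    using assms(2)
  proof (induction U)
    case Empty
    then show ?case by simp
  next
    case (Int a b)
    then obtain \<epsilon> \<R> \<epsilon>' \<R>' where
      "\<epsilon> > 0" "finite \<R>" "\<R> \<subseteq> rectangles n F" "basic_nhd \<kappa> \<epsilon> \<R> \<subseteq> a"
      "\<epsilon>' > 0" "finite \<R>'" "\<R>' \<subseteq> rectangles n F" "basic_nhd \<kappa> \<epsilon>' \<R>' \<subseteq> b"
      by blast
    moreover have "basic_nhd \<kappa> (min \<epsilon> \<epsilon>') (\<R> \<union> \<R>') \<subseteq> basic_nhd \<kappa> \<epsilon> \<R> \<inter> basic_nhd \<kappa> \<epsilon>' \<R>'"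
      by (auto simp: basic_nhd_def)
    ultimately show ?case
      by (intro exI[of _ "min \<epsilon> \<epsilon>'"] exI[of _ "\<R> \<union> \<R>'"]) auto
  next
    case (UN K)
    then show ?case by (meson Union_iff Union_upper subset_trans)
  next
    case (Basis s)
    then obtain \<kappa>' \<epsilon>' \<R> where s: "s = basic_nhd \<kappa>' \<epsilon>' \<R>" "\<epsilon>' > 0" "finite \<R>" "\<R> \<subseteq> rectangles n F"
      unfolding basic_nhd_def by blast
    \<comment> \<open>The slack left by \<open>\<kappa>\<close> in each defining inequality of
      \<open>s\<close>; by the triangle inequality the least slack is a valid radius. Inserting
      \<open>\<epsilon>'\<close> covers the case of empty \<open>\<R>\<close>.\<close>
    define D where "D = insert \<epsilon>' ((\<lambda>R. \<epsilon>' - \<bar>rect_prob n \<kappa>' R - rect_prob n \<kappa> R\<bar>) ` \<R>)"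
    have D: "finite D" "D \<noteq> {}" "\<And>x. x \<in> D \<Longrightarrow> x > 0"
      using s Basis.prems by (auto simp: D_def basic_nhd_def)
    have "basic_nhd \<kappa> (Min D) \<R> \<subseteq> s"
    proof
      fix \<rho> assume \<rho>: "\<rho> \<in> basic_nhd \<kappa> (Min D) \<R>"
      have "\<bar>rect_prob n \<kappa>' R - rect_prob n \<rho> R\<bar> < \<epsilon>'" if "R \<in> \<R>" for R
      proof -
        have "\<bar>rect_prob n \<kappa> R - rect_prob n \<rho> R\<bar> < Min D"
          using \<rho> that by (auto simp: basic_nhd_def)
        also have "Min D \<le> \<epsilon>' - \<bar>rect_prob n \<kappa>' R - rect_prob n \<kappa> R\<bar>"
          using D(1) that by (intro Min_le) (auto simp: D_def)
        finally show ?thesis by linarith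
      qed
      then show "\<rho> \<in> s"
        using \<rho> by (auto simp: s(1) basic_nhd_def)
    qed
    moreover have "Min D > 0" using D by simp
    ultimately show ?case using s by blast
  qed
  then show thesis using that by blast
qed

section \<open>Construction of the two nets\<close>

lemma M_perfect_imp_approximation:
  fixes \<eta> :: real
  assumes "M_perfect \<kappa>" "openin tychonov U" "\<kappa> \<in> U" "0 < \<eta>" "\<eta> \<le> 1"
  obtains \<sigma> \<mu> where "\<sigma> \<in> U" "\<sigma> \<in> profiles" "\<mu> \<in> profiles" "maximal_carrier \<sigma>"
    "best_response strategies \<mu> \<sigma>"
    "\<And>R. R \<in> rectangles n F \<Longrightarrow> \<bar>rect_prob n \<sigma> R - rect_prob n \<mu> R\<bar> \<le> n * \<eta>"
proof -
  obtain \<epsilon> \<tau> \<sigma> where pos: "\<forall>i\<in>{1..n}. \<epsilon> i > 0" and small: "L2_set \<epsilon> {1..n} < \<eta>"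
    and \<tau>: "\<tau> \<in> profiles" "maximal_carrier \<tau>" and \<sigma>: "\<sigma> \<in> U" "nash (perturbed \<tau> \<epsilon>) \<sigma>"
    using assms unfolding M_perfect_def by meson
  \<comment> \<open>Each coordinate is bounded by the Euclidean norm; together with
    \<open>\<eta> \<le> 1\<close> this keeps the weight \<open>1 - \<epsilon> i\<close>
    positive.\<close>
  have \<epsilon>: "0 < \<epsilon> i" "\<epsilon> i < \<eta>" if "i \<in> {1..n}" for i
    using member_le_L2_set[of "{1..n}" i \<epsilon>] small pos that by auto
  have \<epsilon>1: "0 \<le> \<epsilon> i \<and> \<epsilon> i < 1" if "i \<in> {1..n}" for i
    using \<epsilon>[OF that] \<open>\<eta> \<le> 1\<close> by linarith
  obtain \<mu> where \<mu>: "\<mu> \<in> profiles" "\<sigma> \<in> profiles" "best_response strategies \<mu> \<sigma>"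
    and eq: "\<And>i. i \<in> {1..n} \<Longrightarrow> \<sigma> i = (\<lambda>E\<in>F i. (1 - \<epsilon> i) * \<mu> i E + \<epsilon> i * \<tau> i E)"
    using nash_perturbed_best_response[OF \<sigma>(2) \<tau>(1) \<epsilon>1] by blast
  have "0 < \<epsilon> i \<and> \<epsilon> i \<le> 1" "0 \<le> \<epsilon> i \<and> \<epsilon> i \<le> \<eta>" if "i \<in> {1..n}" for i
    using \<epsilon>[OF that] \<epsilon>1[OF that] by linarith+
  then have "maximal_carrier \<sigma>"
    "\<And>R. R \<in> rectangles n F \<Longrightarrow> \<bar>rect_prob n \<sigma> R - rect_prob n \<mu> R\<bar> \<le> n * \<eta>"
    using maximal_carrier_mix[OF \<mu>(1,2) \<tau>(2) eq] rect_prob_mix_diff[OF \<mu>(1,2) \<tau>(1) eq] by blast+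
  then show thesis
    using that \<sigma>(1) \<mu> by blast
qed

lemma M_perfect_imp_perfect:
  assumes M: "M_perfect \<kappa>"
  shows "perfect \<kappa>"
proof -
  have \<kappa>: "\<kappa> \<in> profiles"
    using M unfolding M_perfect_def nash_def best_response_def profiles_def by (elim conjE)
  \<comment> \<open>The number in an index sets the perturbation bound \<open>1 / Suc m\<close> and
    also rules out maximal elements.\<close>
  define I where "I = {U. openin tychonov U \<and> \<kappa> \<in> U} \<times> (UNIV :: nat set)"
  define le where "le p q \<longleftrightarrow> fst q \<subseteq> fst p \<and> snd p \<le> snd q"
    for p q :: "'a profile set \<times> nat"
  have "\<exists>\<sigma> \<mu>. \<sigma> \<in> fst p \<and> \<sigma> \<in> profiles \<and> \<mu> \<in> profiles \<and> maximal_carrier \<sigma> \<and>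
      best_response strategies \<mu> \<sigma> \<and>
      (\<forall>R\<in>rectangles n F. \<bar>rect_prob n \<sigma> R - rect_prob n \<mu> R\<bar> \<le> n * (1 / real (Suc (snd p))))"
    if "p \<in> I" for p
    by (rule M_perfect_imp_approximation[OF M, of "fst p" "1 / real (Suc (snd p))"])
      (use that in \<open>auto simp: I_def\<close>)
  then obtain s k where sk: "\<And>p. p \<in> I \<Longrightarrow> s p \<in> fst p \<and> s p \<in> profiles \<and> k p \<in> profiles \<and>
      maximal_carrier (s p) \<and> best_response strategies (k p) (s p) \<and>
      (\<forall>R\<in>rectangles n F. \<bar>rect_prob n (s p) R - rect_prob n (k p) R\<bar> \<le> n * (1 / real (Suc (snd p))))"
    by metis
  have top: "(profiles, 0) \<in> I"
    using \<kappa> openin_topspace[of tychonov] by (simp add: I_def topspace_tychonov)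
  have "directed_set I le"
    unfolding directed_set_def
  proof (intro conjI ballI impI)
    show "I \<noteq> {}" using top by blast
  next
    fix p q assume "p \<in> I" "q \<in> I"
    then show "\<exists>r\<in>I. le p r \<and> le q r"
      by (intro bexI[of _ "(fst p \<inter> fst q, max (snd p) (snd q))"]) (auto simp: I_def le_def)
  next
    fix p assume "p \<in> I"
    then show "\<exists>q\<in>I. le p q \<and> q \<noteq> p"
      by (intro bexI[of _ "(fst p, Suc (snd p))"]) (auto simp: I_def le_def prod_eq_iff)
  qed (auto simp: le_def)
  moreover have "completely_mixed I le s"
    \<comment> \<open>Any index is a valid threshold, because every \<open>s p\<close> has maximal
      carrier; \<open>top\<close> supplies one.\<close>
    unfolding completely_mixed_def
    using top sk carrier_subset_maximal_carrier by blast
  moreover have "net_converges tychonov I le s \<kappa>"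
    unfolding net_converges_def topspace_tychonov
  proof (intro conjI allI impI \<kappa>)
    fix U assume "openin tychonov U \<and> \<kappa> \<in> U"
    then show "\<exists>a\<in>I. \<forall>b\<in>I. le a b \<longrightarrow> s b \<in> U"
      using sk by (intro bexI[of _ "(U, 0)"]) (auto simp: I_def le_def)
  qed
  moreover have "net_converges tychonov I le k \<kappa>"
    unfolding net_converges_def topspace_tychonov
  proof (intro conjI allI impI \<kappa>)
    fix U assume "openin tychonov U \<and> \<kappa> \<in> U"
    then obtain \<epsilon> \<R> where \<epsilon>: "\<epsilon> > 0" and \<R>: "finite \<R>" "\<R> \<subseteq> rectangles n F"
      and sub: "basic_nhd \<kappa> \<epsilon> \<R> \<subseteq> U"
      using basic_nhd_subset_open by metis
    \<comment> \<open>Half of \<open>\<epsilon>\<close> is spent on the distance from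
      \<open>\<kappa>\<close> to \<open>s b\<close>, controlled by the neighbourhood, and half on
      the distance from \<open>s b\<close> to \<open>k b\<close>, controlled by
      \<open>m\<close>.\<close>
    obtain m :: nat where m: "n / (\<epsilon> / 2) < m"
      using reals_Archimedean2 by blast
    define a where "a = (basic_nhd \<kappa> (\<epsilon> / 2) \<R>, m)"
    have "a \<in> I"
      using openin_basic_nhd[OF \<kappa> _ \<R>, of "\<epsilon> / 2"] \<kappa> \<epsilon> by (simp add: a_def I_def basic_nhd_def)
    moreover have "k b \<in> U" if b: "b \<in> I" "le a b" for b
    proof -
      have "n < m * (\<epsilon> / 2)"
        using m \<epsilon> by (simp add: field_simps)
      also have "\<dots> \<le> real (Suc (snd b)) * (\<epsilon> / 2)"
        using b(2) \<epsilon> by (intro mult_right_mono) (auto simp: le_def a_def)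
      finally have small: "n * (1 / real (Suc (snd b))) < \<epsilon> / 2"
        by (simp add: field_simps)
      have "s b \<in> basic_nhd \<kappa> (\<epsilon> / 2) \<R>"
        using sk[OF b(1)] b(2) by (auto simp: le_def a_def)
      have "\<bar>rect_prob n \<kappa> R - rect_prob n (k b) R\<bar> < \<epsilon>" if "R \<in> \<R>" for R
      proof -
        have "\<bar>rect_prob n \<kappa> R - rect_prob n (s b) R\<bar> < \<epsilon> / 2"
          using \<open>s b \<in> _\<close> that by (auto simp: basic_nhd_def)
        moreover have "\<bar>rect_prob n (s b) R - rect_prob n (k b) R\<bar> \<le> n * (1 / real (Suc (snd b)))"
          using sk[OF b(1)] \<R> that by blast
        ultimately show ?thesis using small by linarith
      qed
      then show ?thesis
        using sub sk[OF b(1)] by (auto simp: basic_nhd_def)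
    qed
    ultimately show "\<exists>a\<in>I. \<forall>b\<in>I. le a b \<longrightarrow> k b \<in> U" by blast
  qed
  ultimately have "perfect_along I le s k \<kappa>"
    unfolding perfect_along_def using sk by auto
  \<comment> \<open>The nets are indexed by neighbourhoods, not by the index type fixed in
    \<open>perfect\<close>, and have to be reindexed.\<close>
  then show ?thesis by (rule perfect_along_imp_perfect)
qed

end

theorem theorem35:
  fixes n :: nat
    and A :: "nat \<Rightarrow> 'a set"
    and F :: "nat \<Rightarrow> 'a set set"
    and u :: "nat \<Rightarrow> (nat \<Rightarrow> 'a) \<Rightarrow> real"
    and \<kappa> :: "'a profile"
  assumes "fa_game n A F u"
    and "fa_game.M_perfect n A F u \<kappa>"
  shows "fa_game.perfect_equilibrium n A F u \<kappa>"
proof -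
  interpret fa_game n A F u by fact
  show ?thesis
    \<comment> \<open>The Nash property is already part of \<open>M_perfect\<close>.\<close>
    using assms(2) M_perfect_imp_perfect by (simp add: perfect_equilibrium_def M_perfect_def)
qed

end
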